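(* Let $T=\Delta$ be the target concept. Let $d\in\mathbb N$ and let $x_d:\Delta^d\to\mathcal X$ be a map, and for $m\ge d$ and $I_d\in\mathcal I_d$ define $$H_{I_d}=G_d\big(\{(\delta_i,\mathbf 1_T(\delta_i))\}_{i\in I_d}\big)=\{\delta\in\Delta:\ g(x_d(\{\delta_i\}_{i\in I_d}),\delta)\le 0\}.$$ Assume that $d$ and $G_d$ are such that, for every $m\ge d$: (1) for all $I_d\in\mathcal I_d$, $H_{I_d}$ is consistent with $\{(\delta_i,\mathbf 1_T(\delta_i))\}_{i\in I_d}$; (2) with $\mathbb P^m$-probability one, for the labeled $m$-multisample $\{(\delta_i,\mathbf 1_T(\delta_i))\}_{i=1}^m$ there exists $I_d\in\mathcal I_d$ such that $H_{I_d}$ is consistent with the whole labeled $m$-multisample. Let $m\ge d$ and let $x_m:\Delta^m\to\mathcal X$ be such that $x_m(\{\delta_i\}_{i=1}^m)=x_d(\{\delta_i\}_{i\in m_d})$ for a set $m_d=m_d(\delta_1,\dots,\delta_m)\in\mathcal I_d$ satisfying (2). Then, for any $\epsilon\in(0,1)$, $$\mathbb P^m\Big\{(\delta_1,\ldots,\delta_m)\in\Delta^m:\ \mathbb P\big(\delta\in\Delta:\ g(x_m(\{\delta_i\}_{i=1}^m),\delta)>0\big)>\epsilon\Big\}\le\binom md(1-\epsilon)^{m-d}.$$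
   Context: $\Delta\subseteq\mathbb R^{n_\delta}$ is a set endowed with a $\sigma$-algebra $\mathcal D$, $\mathbb P$ is a probability measure on $\mathcal D$, and $\mathbb P^m$ is the product measure on $\Delta^m$ (so $\delta_1,\dots,\delta_m$ are i.i.d. with law $\mathbb P$). All involved sets are assumed measurable. $\mathcal X\subset\mathbb R^{n_x}$ and $g:\mathcal X\times\Delta\to\mathbb R$ is a constraint function. $\mathbf 1_C$ is the indicator function of $C$; since $T=\Delta$, $\mathbf 1_T\equiv1$. For an index set $J$, a set $H\in\mathcal D$ is consistent with $\{(\delta_i,\mathbf 1_T(\delta_i))\}_{i\in J}$ iff $\mathbf 1_H(\delta_i)=\mathbf 1_T(\delta_i)$ for all $i\in J$ (here: $\delta_i\in H$ for all $i\in J$). $\mathcal I_d$ is the set of all subsets of $\{1,\dots,m\}$ with $d$ elements; when $x_d$ or $G_d$ is applied to samples indexed by $I_d$, they are listed in increasing order of index. *)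

theory Defs
  imports "HOL-Probability.Probability"
begin

text \<open>Multisamples \<open>(\<delta>\<^sub>1, \<dots>, \<delta>\<^sub>m)\<close> are functions on \<open>{1..m}\<close>, as in the carrier of
  \<open>PiM {1..m} (\<lambda>_. P)\<close>.\<close>

definition index_sets :: "nat \<Rightarrow> nat \<Rightarrow> nat set set" where
  "index_sets m d = {I. I \<subseteq> {1..m} \<and> card I = d}"

text \<open>The entries with index in the finite set \<open>I\<close>, in increasing order of index, renumbered
  as a multisample on \<open>{1..card I}\<close>.\<close>

definition subsample :: "nat set \<Rightarrow> (nat \<Rightarrow> 'a) \<Rightarrow> nat \<Rightarrow> 'a" where
  "subsample I s = (\<lambda>j\<in>{1..card I}. s (sorted_list_of_set I ! (j - 1)))"

definition labelled :: "'a set \<Rightarrow> (nat \<Rightarrow> 'a) \<Rightarrow> nat \<Rightarrow> 'a \<times> real" where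
  "labelled T \<omega> = (\<lambda>i. (\<omega> i, indicator T (\<omega> i)))"

definition consistent :: "'a set \<Rightarrow> nat set \<Rightarrow> (nat \<Rightarrow> 'a \<times> real) \<Rightarrow> bool" where
  "consistent H J s \<longleftrightarrow> (\<forall>i\<in>J. indicator H (fst (s i)) = snd (s i))"

end

theory Submission
  imports Defs
begin

text \<open>By consistency, outside a null set the index set \<open>I = m\<^sub>d(\<omega>)\<close> has all samples in \<open>H\<^sub>I\<close>. For a
  fixed \<open>I\<close>, condition on the samples indexed by \<open>I\<close>: then \<open>H\<^sub>I\<close> is a fixed set and the other
  \<open>m - d\<close> samples are still i.i.d., so if \<open>H\<^sub>I\<close> has probability less than \<open>1 - \<epsilon>\<close>, they all fall
  into it with probability at most \<open>(1 - \<epsilon>)\<^bsup>m - d\<^esup>\<close>. A union bound over \<open>I\<close> gives the claim; it also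
  removes any need for \<open>m\<^sub>d\<close> to be measurable.\<close>

context prob_space
begin

text \<open>Section measures of a measurable set depend measurably on the base point. The set here
  is the complement of \<open>A\<close> within the product space, whose section at \<open>z\<close>
  in \<open>space N\<close> is exactly the displayed set.\<close>

lemma borel_measurable_prob_section:
  assumes "A \<in> sets (N \<Otimes>\<^sub>M M)"
  shows "(\<lambda>z. prob {x \<in> space M. (z, x) \<notin> A}) \<in> borel_measurable N"
proof -
  define B where "B = space (N \<Otimes>\<^sub>M M) - A"
  have "B \<in> sets (N \<Otimes>\<^sub>M M)"
    unfolding B_def using assms by auto
  then have "(\<lambda>z. prob (Pair z -` B)) \<in> borel_measurable N"
    unfolding measure_def by (intro borel_measurable_enn2real measurable_emeasure_Pair)
  moreover have "Pair z -` B = {x \<in> space M. (z, x) \<notin> A}" if "z \<in> space N" for z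
    using that by (auto simp: B_def space_pair_measure)
  ultimately show ?thesis
    by (simp cong: measurable_cong)
qed

text \<open>The section of \<open>A\<close> at \<open>z\<close> plays the role of the hypothesis
  computed from the samples \<open>z\<close> indexed by \<open>I\<close>, and the samples indexed by
  \<open>K\<close> validate it. Disjointness makes the two groups independent, so Fubini reduces the
  bound to one for each fixed \<open>z\<close>.\<close>

lemma
  fixes I K :: "'i set" and \<epsilon> :: real
  assumes fin: "finite I" "finite K" and disj: "I \<inter> K = {}"
    and A: "A \<in> sets (PiM I (\<lambda>_. M) \<Otimes>\<^sub>M M)"
  defines "E \<equiv> {\<omega> \<in> space (PiM (I \<union> K) (\<lambda>_. M)).
    \<epsilon> < prob {x \<in> space M. (restrict \<omega> I, x) \<notin> A} \<and> (\<forall>i\<in>K. (restrict \<omega> I, \<omega> i) \<in> A)}"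
  shows sets_validation_event: "E \<in> sets (PiM (I \<union> K) (\<lambda>_. M))"
    and emeasure_validation_event_le:
      "emeasure (PiM (I \<union> K) (\<lambda>_. M)) E \<le> ennreal ((1 - \<epsilon>) ^ card K)"
proof -
  let ?I = "PiM I (\<lambda>_. M)" and ?K = "PiM K (\<lambda>_. M)" and ?U = "PiM (I \<union> K) (\<lambda>_. M)"
  interpret I: prob_space ?I by (intro prob_space_PiM) unfold_locales
  interpret K: prob_space ?K by (intro prob_space_PiM) unfold_locales
  interpret prod: product_prob_space "\<lambda>_::'i. M" by unfold_locales
  have restr: "(\<lambda>\<omega>. restrict \<omega> I) \<in> ?U \<rightarrow>\<^sub>M ?I"
    by (intro measurable_restrict_subset) auto
  have pair: "(\<lambda>\<omega>. (restrict \<omega> I, \<omega> i)) \<in> ?U \<rightarrow>\<^sub>M ?I \<Otimes>\<^sub>M M" if "i \<in> K" for i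
    using that by (intro measurable_Pair restr measurable_component_singleton) auto
  note measurable_compose[OF restr borel_measurable_prob_section[OF A], measurable]
  have "Measurable.pred ?U (\<lambda>\<omega>. \<epsilon> < prob {x \<in> space M. (restrict \<omega> I, x) \<notin> A})"
    by measurable
  moreover have "Measurable.pred ?U (\<lambda>\<omega>. (restrict \<omega> I, \<omega> i) \<in> A)" if "i \<in> K" for i
    using measurable_compose[OF pair[OF that], of "\<lambda>p. p \<in> A"] A by simp
  ultimately have "Measurable.pred ?U (\<lambda>\<omega>. \<epsilon> < prob {x \<in> space M. (restrict \<omega> I, x) \<notin> A} \<and>
      (\<forall>i\<in>K. (restrict \<omega> I, \<omega> i) \<in> A))"
    using fin by (intro pred_intros_logic pred_intros_finite)
  then show E: "E \<in> sets ?U"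
    unfolding E_def pred_def .
  have merge: "merge I K \<in> ?I \<Otimes>\<^sub>M ?K \<rightarrow>\<^sub>M ?U" by simp
  \<comment> \<open>\<open>merge\<close> identifies pairs of multisamples on \<open>I\<close> and
    \<open>K\<close> with multisamples on the union. Through it \<open>E\<close> becomes an event on
    a product of two spaces, where integration over \<open>z\<close> amounts to conditioning on the
    samples in \<open>I\<close>.\<close>
  define E' where "E' = merge I K -` E \<inter> space (?I \<Otimes>\<^sub>M ?K)"
  have E': "E' \<in> sets (?I \<Otimes>\<^sub>M ?K)"
    unfolding E'_def using merge E by (rule measurable_sets)
  have "emeasure ?U E = emeasure (distr (?I \<Otimes>\<^sub>M ?K) ?U (merge I K)) E"
    using prod.distr_merge[OF disj fin] by simp
  also have "\<dots> = emeasure (?I \<Otimes>\<^sub>M ?K) E'"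
    unfolding E'_def by (rule emeasure_distr[OF merge E])
  also have "\<dots> = (\<integral>\<^sup>+z. emeasure ?K (Pair z -` E') \<partial>?I)"
    by (rule K.emeasure_pair_measure_alt[OF E'])
  also have "\<dots> \<le> (\<integral>\<^sup>+z. ennreal ((1 - \<epsilon>) ^ card K) \<partial>?I)"
  proof (rule nn_integral_mono)
    fix z assume z: "z \<in> space ?I"
    let ?A = "{x \<in> space M. (z, x) \<in> A}"
    have A_z: "?A \<in> sets M"
    proof -
      have "Pair z -` A = ?A"
        using sets.sets_into_space[OF A] by (auto simp: space_pair_measure)
      then show ?thesis using sets_Pair1[OF A, of z] by simp
    qed
    have restr_merge: "restrict (merge I K (z, y)) I = z" for y
      using z disj by (simp add: space_PiM restrict_merge PiE_restrict)
    \<comment> \<open>Once \<open>z\<close> is fixed, the hypothesis no longer varies with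
      \<open>y\<close>, so the validation condition confines \<open>y\<close> to a box.\<close>
    have slice: "Pair z -` E' \<subseteq> Pi\<^sub>E K (\<lambda>_. ?A)"
    proof
      fix y assume "y \<in> Pair z -` E'"
      then have y: "y \<in> space ?K" and K: "\<And>i. i \<in> K \<Longrightarrow> (z, merge I K (z, y) i) \<in> A"
        using z by (simp_all add: E'_def E_def restr_merge space_pair_measure)
      have "(z, y i) \<in> A" if "i \<in> K" for i
        using K[OF that] disj that by simp
      then show "y \<in> Pi\<^sub>E K (\<lambda>_. ?A)"
        using y by (auto simp: space_PiM PiE_iff)
    qed
    \<comment> \<open>The threshold condition depends on \<open>z\<close> alone: either it fails and
      the slice is empty, or it holds and bounds each side of the box.\<close>
    show "emeasure ?K (Pair z -` E') \<le> ennreal ((1 - \<epsilon>) ^ card K)"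
    proof (cases "\<epsilon> < prob {x \<in> space M. (z, x) \<notin> A}")
      case False
      then have "Pair z -` E' = {}"
        by (simp add: E'_def E_def restr_merge vimage_def)
      then show ?thesis by simp
    next
      case True
      have "{x \<in> space M. (z, x) \<notin> A} = space M - ?A" by auto
      then have p: "prob ?A \<le> 1 - \<epsilon>"
        using True prob_compl[OF A_z] by simp
      have "emeasure ?K (Pair z -` E') \<le> emeasure ?K (Pi\<^sub>E K (\<lambda>_. ?A))"
        using A_z fin by (intro emeasure_mono slice sets_PiM_I_finite) auto
      also have "\<dots> = ennreal (prob ?A ^ card K)"
        using A_z fin by (simp add: prod.emeasure_PiM emeasure_eq_measure ennreal_power)
      \<comment> \<open>Monotonicity of powers applies because the smaller base is a probability,
        hence nonnegative.\<close>
      also have "\<dots> \<le> ennreal ((1 - \<epsilon>) ^ card K)"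
        using p by (intro ennreal_leI power_mono) auto
      finally show ?thesis .
    qed
  qed
  also have "\<dots> = ennreal ((1 - \<epsilon>) ^ card K)"
    by (simp add: I.emeasure_space_1)
  finally show "emeasure ?U E \<le> ennreal ((1 - \<epsilon>) ^ card K)" .
qed

end

text \<open>Samples are numbered from 1 but list positions from 0; the shift maps
  \<open>{1..d}\<close> onto the valid positions of a list of length \<open>d\<close>.\<close>

lemma index_sets_nth_mem:
  assumes "I \<in> index_sets m d" "j \<in> {1..d}"
  shows "sorted_list_of_set I ! (j - 1) \<in> I"
proof -
  have "finite I" "card I = d"
    using assms by (auto simp: index_sets_def intro: finite_subset)
  then show ?thesis
    using assms nth_mem[of "j - 1" "sorted_list_of_set I"] by auto
qed

lemma finite_index_sets: "finite (index_sets m d)"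
  by (auto simp: index_sets_def intro: finite_subset[of _ "Pow {1..m}"])

lemma card_index_sets: "card (index_sets m d) = m choose d"
  unfolding index_sets_def using n_subsets[of "{1..m}" d] by simp

text \<open>\<open>subsample I\<close> reads only coordinates in \<open>I\<close>. This lets the
  hypothesis be treated as a function on the factor indexed by \<open>I\<close>, as conditioning on
  that factor requires.\<close>

lemma subsample_restrict:
  assumes "I \<in> index_sets m d"
  shows "subsample I (restrict \<omega> I) = subsample I \<omega>"
  using assms index_sets_nth_mem[OF assms]
  by (auto simp: subsample_def index_sets_def fun_eq_iff)

lemma measurable_subsample:
  assumes "I \<in> index_sets m d"
  shows "subsample I \<in> PiM I (\<lambda>_. M) \<rightarrow>\<^sub>M PiM {1..d} (\<lambda>_. M)"
proof -
  have "card I = d" using assms by (simp add: index_sets_def)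
  then show ?thesis
    unfolding subsample_def using index_sets_nth_mem[OF assms]
    by (auto intro!: measurable_restrict measurable_component_singleton)
qed

text \<open>All labels on \<open>J\<close> equal 1 under the assumption, so agreement of indicators
  becomes plain membership.\<close>

lemma consistent_labelled_iff:
  assumes "\<And>i. i \<in> J \<Longrightarrow> \<omega> i \<in> T"
  shows "consistent H J (labelled T \<omega>) \<longleftrightarrow> (\<forall>i\<in>J. \<omega> i \<in> H)"
  using assms by (auto simp: consistent_def labelled_def indicator_def)

theorem theorem6:
  fixes P :: "(real ^ 'n) measure"
    and \<Delta> T :: "(real ^ 'n) set"
    and X :: "(real ^ 'k) set"
    and g :: "real ^ 'k \<Rightarrow> real ^ 'n \<Rightarrow> real"
    and d m :: nat
    and xd xm :: "(nat \<Rightarrow> real ^ 'n) \<Rightarrow> real ^ 'k"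
    and G :: "(nat \<Rightarrow> (real ^ 'n) \<times> real) \<Rightarrow> (real ^ 'n) set"
    and md :: "(nat \<Rightarrow> real ^ 'n) \<Rightarrow> nat set"
    and \<epsilon> :: real
  assumes prob: "prob_space P" and space: "space P = \<Delta>"
    and target: "T = \<Delta>"
    and xd: "xd \<in> space (PiM {1..d} (\<lambda>_. P)) \<rightarrow> X"
    and G: "\<And>n I \<omega>. n \<ge> d \<Longrightarrow> I \<in> index_sets n d \<Longrightarrow> \<omega> \<in> space (PiM {1..n} (\<lambda>_. P)) \<Longrightarrow>
              G (subsample I (labelled T \<omega>)) = {\<delta> \<in> \<Delta>. g (xd (subsample I \<omega>)) \<delta> \<le> 0}"
    and meas_G: "{(z, \<delta>). z \<in> space (PiM {1..d} (\<lambda>_. P)) \<and> \<delta> \<in> \<Delta> \<and> g (xd z) \<delta> \<le> 0}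
                   \<in> sets (PiM {1..d} (\<lambda>_. P) \<Otimes>\<^sub>M P)"
    and cond1: "\<And>n I \<omega>. n \<ge> d \<Longrightarrow> I \<in> index_sets n d \<Longrightarrow> \<omega> \<in> space (PiM {1..n} (\<lambda>_. P)) \<Longrightarrow>
              consistent (G (subsample I (labelled T \<omega>))) I (labelled T \<omega>)"
    and cond2: "\<And>n. n \<ge> d \<Longrightarrow>
              (AE \<omega> in PiM {1..n} (\<lambda>_. P). \<exists>I\<in>index_sets n d.
                 consistent (G (subsample I (labelled T \<omega>))) {1..n} (labelled T \<omega>))"
    and m_ge_d: "m \<ge> d"
    and md: "md \<in> space (PiM {1..m} (\<lambda>_. P)) \<rightarrow> index_sets m d"
    and md_consistent: "AE \<omega> in PiM {1..m} (\<lambda>_. P).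
              consistent (G (subsample (md \<omega>) (labelled T \<omega>))) {1..m} (labelled T \<omega>)"
    and xm: "xm \<in> space (PiM {1..m} (\<lambda>_. P)) \<rightarrow> X"
    and xm_eq: "\<And>\<omega>. \<omega> \<in> space (PiM {1..m} (\<lambda>_. P)) \<Longrightarrow> xm \<omega> = xd (subsample (md \<omega>) \<omega>)"
    and eps: "\<epsilon> \<in> {0<..<1}"
    and meas_event: "{\<omega> \<in> space (PiM {1..m} (\<lambda>_. P)).
              measure P {\<delta> \<in> \<Delta>. g (xm \<omega>) \<delta> > 0} > \<epsilon>} \<in> sets (PiM {1..m} (\<lambda>_. P))"
  shows "measure (PiM {1..m} (\<lambda>_. P))
           {\<omega> \<in> space (PiM {1..m} (\<lambda>_. P)). measure P {\<delta> \<in> \<Delta>. g (xm \<omega>) \<delta> > 0} > \<epsilon>}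
         \<le> real (m choose d) * (1 - \<epsilon>) ^ (m - d)"
proof -
  interpret P: prob_space P by (rule prob)
  let ?P = "\<lambda>J. PiM J (\<lambda>_. P)"
  let ?Pm = "?P {1..m}"
  interpret Pm: prob_space ?Pm by (intro prob_space_PiM prob)
  \<comment> \<open>The section of \<open>C\<close> at \<open>z\<close> is the hypothesis of the
    decision \<open>xd z\<close>. \<open>A I\<close> pulls \<open>C\<close> back to the samples
    indexed by \<open>I\<close>. \<open>E I\<close> is the bad event for a fixed \<open>I\<close>:
    the violation probability exceeds \<epsilon>, yet all samples outside \<open>I\<close> satisfy
    the constraint.\<close>
  define C where "C = {(z, \<delta>). z \<in> space (?P {1..d}) \<and> \<delta> \<in> \<Delta> \<and> g (xd z) \<delta> \<le> 0}"
  define A where "A I = {p \<in> space (?P I \<Otimes>\<^sub>M P). (subsample I (fst p), snd p) \<in> C}" for I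
  define E where "E I = {\<omega> \<in> space ?Pm. \<epsilon> < P.prob {\<delta> \<in> space P. (restrict \<omega> I, \<delta>) \<notin> A I} \<and>
    (\<forall>i\<in>{1..m} - I. (restrict \<omega> I, \<omega> i) \<in> A I)}" for I
  define F where "F = {\<omega> \<in> space ?Pm. \<epsilon> < P.prob {\<delta> \<in> \<Delta>. g (xm \<omega>) \<delta> > 0}}"
  have A_sets: "A I \<in> sets (?P I \<Otimes>\<^sub>M P)" if I: "I \<in> index_sets m d" for I
  proof -
    have "(\<lambda>p. (subsample I (fst p), snd p)) \<in> ?P I \<Otimes>\<^sub>M P \<rightarrow>\<^sub>M ?P {1..d} \<Otimes>\<^sub>M P"
      using measurable_subsample[OF I, of P] by measurable
    from measurable_sets[OF this, of C] show ?thesis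
      using meas_G by (simp add: A_def C_def vimage_def Int_def conj_commute)
  qed
  have E: "E I \<in> sets ?Pm" "emeasure ?Pm (E I) \<le> ennreal ((1 - \<epsilon>) ^ (m - d))"
    if I: "I \<in> index_sets m d" for I
  proof -
    have I': "I \<subseteq> {1..m}" "finite I" "card I = d"
      using I by (auto simp: index_sets_def intro: finite_subset)
    \<comment> \<open>The validation samples are those outside \<open>I\<close>; their number gives
      the exponent \<open>m - d\<close>.\<close>
    then have U: "I \<union> ({1..m} - I) = {1..m}" and c: "card ({1..m} - I) = m - d"
      by (auto simp: card_Diff_subset)
    show "E I \<in> sets ?Pm"
      using P.sets_validation_event[of I "{1..m} - I" "A I" \<epsilon>] I' A_sets[OF I]
      unfolding E_def U by auto
    show "emeasure ?Pm (E I) \<le> ennreal ((1 - \<epsilon>) ^ (m - d))"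
      using P.emeasure_validation_event_le[of I "{1..m} - I" "A I" \<epsilon>] I' A_sets[OF I]
      unfolding E_def U c by auto
  qed
  have A_iff: "(restrict \<omega> I, \<delta>) \<in> A I \<longleftrightarrow> g (xd (subsample I \<omega>)) \<delta> \<le> 0"
    if I: "I \<in> index_sets m d" and \<omega>: "\<omega> \<in> space ?Pm" and \<delta>: "\<delta> \<in> \<Delta>" for I \<omega> \<delta>
  proof -
    have "restrict \<omega> I \<in> space (?P I)"
      using I \<omega> by (auto simp: index_sets_def space_PiM)
    then show ?thesis
      using measurable_space[OF measurable_subsample[OF I, of P]] \<delta> space
      by (auto simp: A_def C_def space_pair_measure subsample_restrict[OF I, of \<omega>, symmetric])
  qed
  \<comment> \<open>Wherever the chosen set is consistent, a point of \<open>F\<close> lies in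
    \<open>E (md \<omega>)\<close>; the union over all index sets absorbs the dependence of
    \<open>md\<close> on \<omega>.\<close>
  have "AE \<omega> in ?Pm. \<omega> \<in> F \<longrightarrow> \<omega> \<in> (\<Union>I\<in>index_sets m d. E I)"
    using md_consistent
  proof (rule AE_mp, intro AE_I2 impI)
    fix \<omega> assume \<omega>: "\<omega> \<in> space ?Pm" and F: "\<omega> \<in> F"
      and cons: "consistent (G (subsample (md \<omega>) (labelled T \<omega>))) {1..m} (labelled T \<omega>)"
    have I: "md \<omega> \<in> index_sets m d"
      using md \<omega> by auto
    have \<omega>i: "\<omega> i \<in> \<Delta>" if "i \<in> {1..m}" for i
      using \<omega> that space by (auto simp: space_PiM)
    \<comment> \<open>Since \<open>T\<close> is all of \<Delta>, consistency with the whole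
      multisample says that every sample satisfies the constraint at the chosen decision.\<close>
    have "\<forall>i\<in>{1..m}. g (xd (subsample (md \<omega>) \<omega>)) (\<omega> i) \<le> 0"
      using cons \<omega>i consistent_labelled_iff[of "{1..m}" \<omega> T] G[OF m_ge_d I \<omega>] target by auto
    moreover have "{\<delta> \<in> space P. (restrict \<omega> (md \<omega>), \<delta>) \<notin> A (md \<omega>)} = {\<delta> \<in> \<Delta>. g (xm \<omega>) \<delta> > 0}"
      using A_iff[OF I \<omega>] space by (auto simp: xm_eq[OF \<omega>])
    ultimately have "\<omega> \<in> E (md \<omega>)"
      using F \<omega> A_iff[OF I \<omega>] \<omega>i by (auto simp: E_def F_def)
    then show "\<omega> \<in> (\<Union>I\<in>index_sets m d. E I)"
      using I by blast
  qed
  then have "Pm.prob F \<le> Pm.prob (\<Union>I\<in>index_sets m d. E I)"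
    using E finite_index_sets by (intro Pm.finite_measure_mono_AE) auto
  also have "\<dots> \<le> (\<Sum>I\<in>index_sets m d. Pm.prob (E I))"
    using E finite_index_sets by (intro Pm.finite_measure_subadditive_finite) auto
  \<comment> \<open>As \<epsilon> is below 1, the right-hand power is nonnegative, so the
    \<open>ennreal\<close> bound on each \<open>E I\<close> carries over to the reals.\<close>
  also have "\<dots> \<le> (\<Sum>I\<in>index_sets m d. (1 - \<epsilon>) ^ (m - d))"
    using E eps by (intro sum_mono) (simp add: Pm.emeasure_eq_measure del: One_nat_def)
  also have "\<dots> = real (m choose d) * (1 - \<epsilon>) ^ (m - d)"
    by (simp add: card_index_sets)
  finally show ?thesis
    unfolding F_def .
qed

end
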